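(* Let $A\in\mathbb R^{n\times d}$ and let $p\ge1$ (with $p<\infty$). Then there exists $U\in\mathbb R^{n\times s}$ for some $s=O(d\log\log d)$ such that (1) $\|U\|_{p,p}\le s^{1/p}$, and (2) for any $x\in\mathbb R^d$ there exists $z\in\mathbb R^s$ such that $Ax=Uz$ and $\|z\|_2\le O(1)\,\|Uz\|_p$.
   Context: $\|U\|_{p,p}=\big(\sum_{i,j}|U_{i,j}|^p\big)^{1/p}$ is the entrywise $\ell_p$ norm. $O(\cdot)$ hides absolute constants; $\log\log d$ is read as at least $1$. *)

theory Defs
  imports Complex_Main "Jordan_Normal_Form.Matrix"
begin

text \<open>Both norms are meant for finite exponents \<open>p \<ge> 1\<close>. Since \<open>0 powr p = 0\<close>, zero entries
  and the empty vector or matrix are handled correctly.\<close>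

definition lp_norm :: "real \<Rightarrow> real vec \<Rightarrow> real" where
  "lp_norm p v = (\<Sum>i<dim_vec v. \<bar>vec_index v i\<bar> powr p) powr (1 / p)"

definition entrywise_lp_norm :: "real \<Rightarrow> real mat \<Rightarrow> real" where
  "entrywise_lp_norm p U =
     (\<Sum>i<dim_row U. \<Sum>j<dim_col U. \<bar>index_mat U (i, j)\<bar> powr p) powr (1 / p)"

text \<open>The iterated logarithm is read as at least \<open>1\<close>; this also covers \<open>d \<le> 2\<close>, where
  \<open>ln (ln d)\<close> is not a meaningful (or not a positive) quantity.\<close>

definition loglog :: "nat \<Rightarrow> real" where
  "loglog d = max 1 (ln (ln (real d)))"

end

(* Idea: write A = B R with B injective, and let K be the bounded set of all v with |B v|_p <= 1.
   Choose 2 r vectors in K, r being the rank of A, as the columns of a matrix V for which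
   det (V V^T) is within a factor 2 of its supremum. Exchanging one column for an arbitrary x in K
   cannot double the determinant; summed over all columns this gives x . (V V^T)^-1 x <= 3, which
   is the squared length of the minimal-norm solution z of V z = x. Then U = B V works, with
   s = 2 r columns. *)

theory Submission
  imports Defs "Jordan_Normal_Form.Determinant"
begin

section \<open>Determinants under low-rank updates\<close>

text \<open>Sylvester's determinant identity (Weinstein-Aronszajn). Multiplying \<open>?X\<close> by
  the unipotent \<open>?Y\<close> on either side clears the block \<open>- P\<close>; the two block
  triangular products have the two sides as determinants, and
  \<open>det (?X * ?Y) = det (?Y * ?X)\<close>.\<close>

lemma det_one_plus_mult_commute:
  fixes P Q :: "'a::idom mat"
  assumes P: "P \<in> carrier_mat n m" and Q: "Q \<in> carrier_mat m n"
  shows "det (1\<^sub>m n + P * Q) = det (1\<^sub>m m + Q * P)"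
proof -
  let ?X = "four_block_mat (1\<^sub>m n) (- P) Q (1\<^sub>m m)"
  let ?Y = "four_block_mat (1\<^sub>m n) P (0\<^sub>m m n) (1\<^sub>m m)"
  have PQ: "P * Q \<in> carrier_mat n n" and QP: "Q * P \<in> carrier_mat m m"
    using P Q by auto
  have X: "?X \<in> carrier_mat (n + m) (n + m)" and Y: "?Y \<in> carrier_mat (n + m) (n + m)"
    using P Q by auto
  have detY: "det ?Y = 1"
    by (subst det_four_block_mat_lower_left_zero[of _ n _ m]) (use P in auto)
  have "?X * ?Y = four_block_mat (1\<^sub>m n) (0\<^sub>m n m) Q (Q * P + 1\<^sub>m m)"
    by (subst mult_four_block_mat[of _ n n _ m _ m _ _ n _ m]) (use P Q in auto)
  then have "det (?X * ?Y) = det (Q * P + 1\<^sub>m m)"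
    using det_four_block_mat_upper_right_zero[of "1\<^sub>m n" n "0\<^sub>m n m" m Q "Q * P + 1\<^sub>m m"] P Q
    by auto
  moreover have "Q * P + 1\<^sub>m m = 1\<^sub>m m + Q * P"
    by (rule comm_add_mat) (use QP in auto)
  moreover have "?Y * ?X = four_block_mat (1\<^sub>m n + P * Q) (0\<^sub>m n m) Q (1\<^sub>m m)"
    by (subst mult_four_block_mat[of _ n n _ m _ m _ _ n _ m]) (use P Q in auto)
  then have "det (?Y * ?X) = det (1\<^sub>m n + P * Q)"
    using det_four_block_mat_upper_right_zero[of "1\<^sub>m n + P * Q" n "0\<^sub>m n m" m Q "1\<^sub>m m"] P Q
    by auto
  ultimately show ?thesis
    using det_mult[OF X Y] det_mult[OF Y X] by (simp add: mult.commute)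
qed

lemma det_mat_2:
  fixes A :: "'a::comm_ring_1 mat"
  assumes A: "A \<in> carrier_mat 2 2"
  shows "det A = A $$ (0,0) * A $$ (1,1) - A $$ (0,1) * A $$ (1,0)"
proof -
  have d: "mat_delete A i 0 \<in> carrier_mat 1 1" for i
    using A by (auto simp: mat_delete_def)
  have "det A = (\<Sum>i<2. A $$ (i,0) * cofactor A i 0)"
    by (rule laplace_expansion_column[OF A]) simp
  also have "\<dots> = A $$ (0,0) * det (mat_delete A 0 0) - A $$ (1,0) * det (mat_delete A 1 0)"
    by (simp add: numeral_2_eq_2 cofactor_def)
  also have "\<dots> = A $$ (0,0) * A $$ (1,1) - A $$ (1,0) * A $$ (0,1)"
    unfolding det_single[OF d] using A by (simp add: mat_delete_def)
  finally show ?thesis by (simp add: mult.commute)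
qed

text \<open>Adding \<open>x x^T\<close> and removing \<open>u u^T\<close> is a rank-two update: the
  new matrix is \<open>M (1 + N P Q)\<close> with \<open>P = [x, -u]\<close> and \<open>Q\<close>
  having rows \<open>x\<close>, \<open>u\<close>. Sylvester's identity turns the second factor into
  a 2 by 2 determinant. This measures the effect on \<open>det (U U^T)\<close> of replacing the
  column \<open>u\<close> of \<open>U\<close> by \<open>x\<close>.\<close>

lemma det_exchange:
  fixes M N :: "'a::idom mat"
  assumes M: "M \<in> carrier_mat n n" and N: "N \<in> carrier_mat n n" and MN: "M * N = 1\<^sub>m n"
    and x: "x \<in> carrier_vec n" and u: "u \<in> carrier_vec n"
  shows "det (mat n n (\<lambda>(a,b). M $$ (a,b) + x $ a * x $ b - u $ a * u $ b)) =
    det M * ((1 + x \<bullet> (N *\<^sub>v x)) * (1 - u \<bullet> (N *\<^sub>v u)) + (x \<bullet> (N *\<^sub>v u)) * (u \<bullet> (N *\<^sub>v x)))"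
    (is "det ?M' = _")
proof -
  define P where "P = mat n 2 (\<lambda>(a,j). if j = 0 then x $ a else - (u $ a))"
  define Q where "Q = mat 2 n (\<lambda>(j,a). if j = 0 then x $ a else u $ a)"
  have P: "P \<in> carrier_mat n 2" and Q: "Q \<in> carrier_mat 2 n"
    unfolding P_def Q_def by auto
  have NP: "N * P \<in> carrier_mat n 2" using N P by auto
  have cP: "col P 0 = x" "col P 1 = - u" and rQ: "row Q 0 = x" "row Q 1 = u"
    unfolding P_def Q_def using x u by (auto intro!: eq_vecI)
  have Nu: "N *\<^sub>v (- u) = - (N *\<^sub>v u)"
    using N u by (intro eq_vecI) (auto simp: scalar_prod_uminus_right)
  have cNP: "col (N * P) 0 = N *\<^sub>v x" "col (N * P) 1 = - (N *\<^sub>v u)"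
    using col_mult2[OF N P, of 0] col_mult2[OF N P, of 1] unfolding cP Nu by simp_all
  have "M * (1\<^sub>m n + (N * P) * Q) = M * 1\<^sub>m n + M * ((N * P) * Q)"
    by (rule mult_add_distrib_mat) (use M NP Q in auto)
  also have "M * ((N * P) * Q) = P * Q"
    using assoc_mult_mat[OF M NP Q] assoc_mult_mat[OF M N P] MN P by simp
  also have "M * 1\<^sub>m n + P * Q = ?M'"
    using M P Q by (intro eq_matI) (auto simp: scalar_prod_def P_def Q_def numeral_2_eq_2)
  finally have "det ?M' = det M * det (1\<^sub>m n + (N * P) * Q)"
    using det_mult[OF M, of "1\<^sub>m n + (N * P) * Q"] NP Q by simp
  also have "det (1\<^sub>m n + (N * P) * Q) = det (1\<^sub>m 2 + Q * (N * P))"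
    by (rule det_one_plus_mult_commute[OF NP Q])
  \<comment> \<open>The entries of \<open>Q * (N * P)\<close> are the pairings of \<open>x\<close>,
    \<open>u\<close> with \<open>N x\<close>, \<open>- N u\<close>; the minus sign makes the
    off-diagonal product enter with a plus.\<close>
  also have "\<dots> = (1 + x \<bullet> (N *\<^sub>v x)) * (1 - u \<bullet> (N *\<^sub>v u)) + (x \<bullet> (N *\<^sub>v u)) * (u \<bullet> (N *\<^sub>v x))"
  proof -
    have "(1\<^sub>m 2 + Q * (N * P)) $$ (i,j) = 1\<^sub>m 2 $$ (i,j) + row Q i \<bullet> col (N * P) j"
      if "i < 2" "j < 2" for i j
      using that Q NP by (subst index_add_mat) (auto simp del: One_nat_def)
    then show ?thesis
      using det_mat_2[of "1\<^sub>m 2 + Q * (N * P)"] Q NP N x u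
      by (simp only: cNP rQ) (simp add: scalar_prod_uminus_right del: One_nat_def index_mult_mat_vec)
  qed
  finally show ?thesis .
qed

section \<open>Full-rank factorization\<close>

text \<open>Columns are added one at a time, as in Gram-Schmidt: the new column is
  \<open>B c\<close> plus a residue \<open>y\<close>, which is appended to \<open>B\<close> only if
  it is nonzero. The left inverse \<open>L\<close> is carried along as an explicit witness that
  \<open>B\<close> is injective.\<close>

lemma full_rank_factorization:
  fixes A :: "'a::linordered_field mat"
  assumes "A \<in> carrier_mat n d"
  shows "\<exists>r B L R. r \<le> d \<and> B \<in> carrier_mat n r \<and> L \<in> carrier_mat r n \<and> R \<in> carrier_mat r d \<and>
    A = B * R \<and> L * B = 1\<^sub>m r"
  using assms
proof (induction d arbitrary: A)
  case 0
  show ?case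
    by (rule exI[of _ 0], rule exI[of _ "0\<^sub>m n 0"], rule exI[of _ "0\<^sub>m 0 n"],
        rule exI[of _ "0\<^sub>m 0 0"]) (use 0 in auto)
next
  case (Suc d)
  note A = Suc.prems
  define A' where "A' = mat n d (\<lambda>(i,j). A $$ (i,j))"
  define a where "a = col A d"
  have A': "A' \<in> carrier_mat n d" and a: "a \<in> carrier_vec n"
    using A by (auto simp: A'_def a_def)
  from Suc.IH[OF A'] obtain r B L R where r: "r \<le> d" and B: "B \<in> carrier_mat n r"
    and L: "L \<in> carrier_mat r n" and R: "R \<in> carrier_mat r d" and AB: "A' = B * R" and LB: "L * B = 1\<^sub>m r"
    by blast
  \<comment> \<open>If \<open>a\<close> lies in the range of \<open>B\<close>, its coefficients must
    be \<open>L a\<close>; in general this choice leaves a residue \<open>y\<close> with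
    \<open>L y = 0\<close>.\<close>
  define c where "c = L *\<^sub>v a"
  define y where "y = a - B *\<^sub>v c"
  have c: "c \<in> carrier_vec r" unfolding c_def by (rule mult_mat_vec_carrier[OF L a])
  have y: "y \<in> carrier_vec n" using a B c by (simp add: y_def)
  have cols: "A $$ (i,j) = (\<Sum>k=0..<r. B $$ (i,k) * R $$ (k,j))" if "i < n" "j < d" for i j
    using arg_cong[OF AB, of "\<lambda>X. X $$ (i,j)"] that B R A by (simp add: A'_def scalar_prod_def)
  have coly: "A $$ (i,d) = (\<Sum>k=0..<r. B $$ (i,k) * c $ k) + y $ i" if "i < n" for i
    using that A B c a by (simp add: y_def a_def scalar_prod_def)
  have LBe: "(\<Sum>k=0..<n. L $$ (i,k) * B $$ (k,j)) = (if i = j then 1 else 0)" if "i < r" "j < r" for i j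
    using arg_cong[OF LB, of "\<lambda>X. X $$ (i,j)"] that B L by (simp add: scalar_prod_def)
  show ?case
  proof (cases "y = 0\<^sub>v n")
    case True
    define R' where "R' = mat r (Suc d) (\<lambda>(i,j). if j < d then R $$ (i,j) else c $ i)"
    have "A = B * R'"
      using A B cols coly True by (intro eq_matI) (auto simp: R'_def scalar_prod_def less_Suc_eq)
    moreover have "R' \<in> carrier_mat r (Suc d)" by (simp add: R'_def)
    ultimately show ?thesis using r B L LB le_SucI by blast
  next
    case False
    define q where "q = y \<bullet> y"
    \<comment> \<open>In an ordered field a sum of squares vanishes only if every term does.\<close>
    have q: "q \<noteq> 0"
    proof
      assume "q = 0"
      then have "\<forall>i\<in>{0..<n}. y $ i * y $ i = 0"
        using y by (subst sum_nonneg_eq_0_iff[symmetric]) (auto simp: q_def scalar_prod_def)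
      then have "y = 0\<^sub>v n" using y by (intro eq_vecI) auto
      with False show False by simp
    qed
    have Ly: "L *\<^sub>v y = 0\<^sub>v r"
    proof -
      have "L *\<^sub>v y = L *\<^sub>v a - L *\<^sub>v (B *\<^sub>v c)"
        unfolding y_def by (rule mult_minus_distrib_mat_vec[OF L a]) (use B c in auto)
      also have "L *\<^sub>v (B *\<^sub>v c) = c"
        using assoc_mult_mat_vec[OF L B c] LB c by simp
      finally show ?thesis using c by (auto simp: c_def)
    qed
    have Lye: "(\<Sum>k=0..<n. L $$ (i,k) * y $ k) = 0" if "i < r" for i
      using arg_cong[OF Ly, of "\<lambda>v. v $ i"] that L y by (simp add: scalar_prod_def)
    define e where "e = B\<^sup>T *\<^sub>v y"
    have e: "e \<in> carrier_vec r" using B by (intro carrier_vecI) (simp add: e_def)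
    \<comment> \<open>The new row of the left inverse is \<open>y^T (1 - B L) / q\<close>. It kills
      the columns of \<open>B\<close> because \<open>L B = 1\<close>, and sends \<open>y\<close> to
      1 because \<open>L y = 0\<close>.\<close>
    define l where "l = vec n (\<lambda>k. (y $ k - (\<Sum>m=0..<r. e $ m * L $$ (m,k))) / q)"
    have l: "l \<in> carrier_vec n" by (simp add: l_def)
    have lsum: "(\<Sum>k=0..<n. l $ k * f k) =
        ((\<Sum>k=0..<n. y $ k * f k) - (\<Sum>m=0..<r. e $ m * (\<Sum>k=0..<n. L $$ (m,k) * f k))) / q" for f
    proof -
      have "(\<Sum>k=0..<n. l $ k * f k) =
          (\<Sum>k=0..<n. (y $ k * f k - (\<Sum>m=0..<r. e $ m * (L $$ (m,k) * f k))) / q)"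
        by (intro sum.cong) (auto simp: l_def left_diff_distrib sum_distrib_right mult.assoc)
      also have "\<dots> = ((\<Sum>k=0..<n. y $ k * f k)
          - (\<Sum>k=0..<n. \<Sum>m=0..<r. e $ m * (L $$ (m,k) * f k))) / q"
        by (simp add: sum_subtractf sum_divide_distrib[symmetric])
      also have "(\<Sum>k=0..<n. \<Sum>m=0..<r. e $ m * (L $$ (m,k) * f k))
          = (\<Sum>m=0..<r. e $ m * (\<Sum>k=0..<n. L $$ (m,k) * f k))"
        by (subst sum.swap) (simp add: sum_distrib_left)
      finally show ?thesis .
    qed
    have ly: "(\<Sum>k=0..<n. l $ k * y $ k) = 1"
      using q y by (simp add: lsum Lye) (simp add: q_def scalar_prod_def)
    have lB: "(\<Sum>k=0..<n. l $ k * B $$ (k,j)) = 0" if "j < r" for j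
    proof -
      have "(\<Sum>m=0..<r. e $ m * (\<Sum>k=0..<n. L $$ (m,k) * B $$ (k,j))) = e $ j"
        using that by (simp add: LBe if_distrib[of "\<lambda>x. _ * x"] sum.delta cong: if_cong)
      moreover have "e $ j = (\<Sum>k=0..<n. y $ k * B $$ (k,j))"
        using that B y by (simp add: e_def scalar_prod_def mult.commute)
      ultimately show ?thesis by (simp add: lsum)
    qed
    define B' where "B' = mat n (Suc r) (\<lambda>(i,j). if j < r then B $$ (i,j) else y $ i)"
    define L' where "L' = mat (Suc r) n (\<lambda>(i,j). if i < r then L $$ (i,j) else l $ j)"
    define R' where "R' = mat (Suc r) (Suc d) (\<lambda>(i,j). if i < r then
      (if j < d then R $$ (i,j) else c $ i) else (if j < d then 0 else 1))"
    have "A = B' * R'"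
      using A cols coly
      by (intro eq_matI) (auto simp: B'_def R'_def scalar_prod_def less_Suc_eq)
    moreover have "L' * B' = 1\<^sub>m (Suc r)"
      using LBe Lye ly lB
      by (intro eq_matI) (auto simp: B'_def L'_def scalar_prod_def less_Suc_eq)
    moreover have "B' \<in> carrier_mat n (Suc r)" "L' \<in> carrier_mat (Suc r) n"
      "R' \<in> carrier_mat (Suc r) (Suc d)"
      by (simp_all add: B'_def L'_def R'_def)
    ultimately show ?thesis using r Suc_le_mono by blast
  qed
qed

section \<open>A nearly D-optimal design\<close>

text \<open>A crude bound from the Leibniz expansion; below it serves only to make a supremum of
  determinants finite.\<close>

lemma abs_det_le:
  fixes A :: "'a::linordered_idom mat"
  assumes A: "A \<in> carrier_mat n n" and C: "\<And>i j. i < n \<Longrightarrow> j < n \<Longrightarrow> \<bar>A $$ (i,j)\<bar> \<le> C"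
  shows "\<bar>det A\<bar> \<le> fact n * C ^ n"
proof -
  have "\<bar>det A\<bar> \<le> (\<Sum>p | p permutes {0..<n}. \<bar>signof p * (\<Prod>i=0..<n. A $$ (i, p i))\<bar>)"
    unfolding det_def'[OF A] by (rule sum_abs)
  also have "\<dots> \<le> (\<Sum>p | p permutes {0..<n}. C ^ n)"
  proof (rule sum_mono)
    fix p assume "p \<in> {p. p permutes {0..<n}}"
    then have p: "p i < n" if "i < n" for i
      using that permutes_in_image[of p "{0..<n}" i] by auto
    have "\<bar>signof p * (\<Prod>i=0..<n. A $$ (i, p i))\<bar> = (\<Prod>i=0..<n. \<bar>A $$ (i, p i)\<bar>)"
      by (simp add: abs_mult abs_prod sign_def)
    also have "\<dots> \<le> (\<Prod>i=0..<n. C)"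
      by (rule prod_mono) (use p C in auto)
    finally show "\<bar>signof p * (\<Prod>i=0..<n. A $$ (i, p i))\<bar> \<le> C ^ n" by simp
  qed
  also have "\<dots> = fact n * C ^ n"
    by (simp add: card_permutations[OF refl])
  finally show ?thesis .
qed

text \<open>Boundedness of \<open>K\<close> makes the supremum of the determinants finite, and the
  scaled unit vectors make it positive. An approximate maximizer suffices, so \<open>K\<close> may
  fail to be closed. Taking \<open>2 * r\<close> columns rather than \<open>r\<close> is what makes
  the final bound independent of \<open>r\<close>.\<close>

lemma near_D_optimal_design:
  fixes K :: "real vec set"
  assumes K: "K \<subseteq> carrier_vec r" and bd: "\<And>x i. x \<in> K \<Longrightarrow> i < r \<Longrightarrow> \<bar>x $ i\<bar> \<le> c"
    and zero: "0\<^sub>v r \<in> K" and \<delta>: "\<delta> > 0" and unit: "\<And>i. i < r \<Longrightarrow> \<delta> \<cdot>\<^sub>v unit_vec r i \<in> K"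
  shows "\<exists>U \<in> carrier_mat r (2 * r). (\<forall>j < 2 * r. col U j \<in> K) \<and>
    (\<forall>x \<in> K. \<exists>z \<in> carrier_vec (2 * r). U *\<^sub>v z = x \<and> z \<bullet> z \<le> 3)"
proof -
  define s where "s = 2 * r"
  define F where "F = {U \<in> carrier_mat r s. \<forall>j < s. col U j \<in> K}"
  \<comment> \<open>The determinant of a Gram matrix is nonnegative; the absolute value spares a
    proof of this.\<close>
  define D where "D = (\<lambda>U::real mat. \<bar>det (U * U\<^sup>T)\<bar>)"
  have entry: "(U * U\<^sup>T) $$ (a,b) = (\<Sum>l=0..<s. U $$ (a,l) * U $$ (b,l))"
    if "U \<in> carrier_mat r s" "a < r" "b < r" for U :: "real mat" and a b
    using that by (simp add: scalar_prod_def)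
  have "D U \<le> fact r * (real s * (c * c)) ^ r" if U: "U \<in> F" for U
    unfolding D_def
  proof (rule abs_det_le)
    have Uc: "U \<in> carrier_mat r s" using U by (simp add: F_def)
    then show "U * U\<^sup>T \<in> carrier_mat r r" by simp
    fix a b assume ab: "a < r" "b < r"
    have Ub: "\<bar>U $$ (a,l)\<bar> \<le> c" if "a < r" "l < s" for a l
      using bd[of "col U l" a] U Uc that by (simp add: F_def)
    have "\<bar>(U * U\<^sup>T) $$ (a,b)\<bar> \<le> (\<Sum>l=0..<s. \<bar>U $$ (a,l) * U $$ (b,l)\<bar>)"
      unfolding entry[OF Uc ab] by (rule sum_abs)
    also have "\<dots> \<le> (\<Sum>l=0..<s. c * c)"
    proof (rule sum_mono)
      fix l assume "l \<in> {0..<s}"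
      then show "\<bar>U $$ (a,l) * U $$ (b,l)\<bar> \<le> c * c"
        using Ub[of a l] Ub[of b l] ab unfolding abs_mult by (intro mult_mono) auto
    qed
    finally show "\<bar>(U * U\<^sup>T) $$ (a,b)\<bar> \<le> real s * (c * c)" by simp
  qed
  then have bdd: "bdd_above (D ` F)" by (rule bdd_aboveI2)
  \<comment> \<open>The scaled unit vectors padded with zero columns: an admissible matrix with
    \<open>U0 U0^T = \<delta>^2 1\<close>, hence with positive determinant.\<close>
  define U0 where "U0 = mat r s (\<lambda>(a,l). if a = l then \<delta> else 0)"
  have U0c: "U0 \<in> carrier_mat r s" by (simp add: U0_def)
  have "col U0 j \<in> K" if j: "j < s" for j
  proof (cases "j < r")
    case True
    then have "col U0 j = \<delta> \<cdot>\<^sub>v unit_vec r j"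
      using j by (intro eq_vecI) (auto simp: U0_def unit_vec_def)
    then show ?thesis using unit True by simp
  next
    case False
    then have "col U0 j = 0\<^sub>v r"
      using j by (intro eq_vecI) (auto simp: U0_def)
    then show ?thesis using zero by simp
  qed
  then have U0: "U0 \<in> F" by (simp add: F_def U0c)
  have "U0 * U0\<^sup>T = (\<delta>\<^sup>2) \<cdot>\<^sub>m 1\<^sub>m r"
    using U0c entry[OF U0c]
    by (intro eq_matI)
      (auto simp: U0_def s_def power2_eq_square if_distrib[of "\<lambda>x. x * _"] sum.delta cong: if_cong)
  then have D0: "D U0 > 0" using \<delta> by (simp add: D_def)
  define T where "T = Sup (D ` F)"
  have T: "D U \<le> T" if "U \<in> F" for U
    unfolding T_def by (rule cSup_upper) (use bdd that in auto)
  have "T > 0" using D0 T[OF U0] by simp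
  then have "T / 2 < Sup (D ` F)" by (simp add: T_def)
  then obtain U where U: "U \<in> F" and DU: "T / 2 < D U"
    using less_cSupE[of "T / 2" "D ` F"] U0 by blast
  have Uc: "U \<in> carrier_mat r s" and UK: "\<And>j. j < s \<Longrightarrow> col U j \<in> K"
    using U by (auto simp: F_def)
  define M where "M = U * U\<^sup>T"
  have M: "M \<in> carrier_mat r r" using Uc by (simp add: M_def)
  have dM: "det M \<noteq> 0" using DU \<open>T > 0\<close> by (auto simp: D_def M_def)
  obtain N where N: "N \<in> carrier_mat r r" and NM: "N * M = 1\<^sub>m r" and MN: "M * N = 1\<^sub>m r"
    using det_non_zero_imp_unit[OF M dM, of "()"] by (auto simp: Units_def ring_mat_simps)
  \<comment> \<open>The leverage scores of the columns sum to the trace of \<open>N M\<close>, which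
    is the identity of size \<open>r\<close>.\<close>
  have trace: "(\<Sum>i=0..<s. col U i \<bullet> (N *\<^sub>v col U i)) = real r"
  proof -
    have "(\<Sum>i=0..<s. col U i \<bullet> (N *\<^sub>v col U i)) =
        (\<Sum>i=0..<s. \<Sum>a=0..<r. \<Sum>b=0..<r. N $$ (a,b) * (U $$ (b,i) * U $$ (a,i)))"
      using Uc N by (intro sum.cong refl) (simp add: scalar_prod_def sum_distrib_left mult_ac)
    also have "\<dots> = (\<Sum>a=0..<r. \<Sum>b=0..<r. \<Sum>i=0..<s. N $$ (a,b) * (U $$ (b,i) * U $$ (a,i)))"
      by (subst sum.swap, rule sum.cong[OF refl], rule sum.swap)
    also have "\<dots> = (\<Sum>a=0..<r. \<Sum>b=0..<r. N $$ (a,b) * M $$ (b,a))"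
      using Uc by (intro sum.cong refl) (simp add: M_def scalar_prod_def sum_distrib_left)
    also have "\<dots> = (\<Sum>a=0..<r. (N * M) $$ (a,a))"
      using N M by (intro sum.cong refl) (simp add: scalar_prod_def)
    finally show ?thesis by (simp add: NM)
  qed
  have "\<exists>z \<in> carrier_vec s. U *\<^sub>v z = x \<and> z \<bullet> z \<le> 3" if xK: "x \<in> K" for x
  proof -
    have x: "x \<in> carrier_vec r" using xK K by auto
    \<comment> \<open>The minimal-norm solution of \<open>U z = x\<close>; its squared length is
      \<open>k\<close>.\<close>
    define z where "z = U\<^sup>T *\<^sub>v (N *\<^sub>v x)"
    define k where "k = x \<bullet> (N *\<^sub>v x)"
    have Nx: "N *\<^sub>v x \<in> carrier_vec r" using N x by simp
    have z: "z \<in> carrier_vec s" using Uc by (intro carrier_vecI) (simp add: z_def)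
    have zi: "z $ i = col U i \<bullet> (N *\<^sub>v x)" if "i < s" for i
      using that Uc by (simp add: z_def)
    have Uz: "U *\<^sub>v z = x"
    proof -
      have "U *\<^sub>v z = M *\<^sub>v (N *\<^sub>v x)"
        unfolding z_def M_def by (rule assoc_mult_mat_vec[symmetric]) (use Uc Nx in auto)
      also have "\<dots> = (M * N) *\<^sub>v x" by (rule assoc_mult_mat_vec[symmetric, OF M N x])
      finally show ?thesis using x by (simp add: MN)
    qed
    have zz: "z \<bullet> z = k"
      using transpose_vec_mult_scalar[OF Uc z Nx] comm_scalar_prod[OF x Nx]
      by (simp add: z_def[symmetric] Uz k_def)
    \<comment> \<open>By linearity the sum is the pairing of \<open>x\<close> with
      \<open>N (U z)\<close>, and \<open>U z = x\<close>. Moving \<open>N\<close> to the left as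
      \<open>w = N^T x\<close> makes the linearity explicit.\<close>
    have cross: "(\<Sum>i=0..<s. (x \<bullet> (N *\<^sub>v col U i)) * z $ i) = k"
    proof -
      define w where "w = N\<^sup>T *\<^sub>v x"
      have w: "w \<in> carrier_vec r" using N by (intro carrier_vecI) (simp add: w_def)
      have wN: "x \<bullet> (N *\<^sub>v v) = w \<bullet> v" if "v \<in> carrier_vec r" for v
        unfolding w_def by (rule transpose_vec_mult_scalar[OF N that x, symmetric])
      have "(\<Sum>i=0..<s. (x \<bullet> (N *\<^sub>v col U i)) * z $ i) =
          (\<Sum>i=0..<s. \<Sum>a=0..<r. w $ a * (U $$ (a,i) * z $ i))"
      proof (intro sum.cong refl)
        fix i assume "i \<in> {0..<s}"
        then show "(x \<bullet> (N *\<^sub>v col U i)) * z $ i = (\<Sum>a=0..<r. w $ a * (U $$ (a,i) * z $ i))"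
          using wN[of "col U i"] Uc by (simp add: scalar_prod_def[of w] sum_distrib_right mult.assoc)
      qed
      also have "\<dots> = (\<Sum>a=0..<r. w $ a * (U *\<^sub>v z) $ a)"
        using Uc z by (subst sum.swap) (simp add: scalar_prod_def sum_distrib_left)
      also have "\<dots> = w \<bullet> x" using x by (simp add: Uz scalar_prod_def)
      finally show ?thesis by (simp add: k_def wN[OF x])
    qed
    \<comment> \<open>The factor by which \<open>det M\<close> changes when column \<open>i\<close>
      is replaced by \<open>x\<close>. The exchanged matrix is still admissible and
      \<open>D U\<close> exceeds half the supremum, so the factor is at most 2.\<close>
    define q where "q = (\<lambda>i. (1 + k) * (1 - col U i \<bullet> (N *\<^sub>v col U i)) + (x \<bullet> (N *\<^sub>v col U i)) * z $ i)"
    have "q i \<le> 2" if i: "i < s" for i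
    proof -
      define U' where "U' = mat r s (\<lambda>(a,l). if l = i then x $ a else U $$ (a,l))"
      have U'c: "U' \<in> carrier_mat r s" by (simp add: U'_def)
      have "col U' j \<in> K" if "j < s" for j
      proof -
        have "col U' j = (if j = i then x else col U j)"
          using that x Uc by (auto intro!: eq_vecI simp: U'_def)
        then show ?thesis using xK UK that by simp
      qed
      then have DU': "D U' \<le> T" using U'c by (intro T) (simp add: F_def)
      \<comment> \<open>Each entry is a sum over columns, and only the summand of column
        \<open>i\<close> changes.\<close>
      have "U' * U'\<^sup>T = mat r r (\<lambda>(a,b). M $$ (a,b) + x $ a * x $ b - col U i $ a * col U i $ b)"
      proof (rule eq_matI; clarsimp)
        fix a b assume ab: "a < r" "b < r"
        have "(U' * U'\<^sup>T) $$ (a,b) = x $ a * x $ b + (\<Sum>l\<in>{0..<s}-{i}. U $$ (a,l) * U $$ (b,l))"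
          unfolding entry[OF U'c ab] using i ab
          by (subst sum.remove[of _ i]) (auto simp: U'_def intro!: sum.cong)
        moreover have "M $$ (a,b) = U $$ (a,i) * U $$ (b,i) + (\<Sum>l\<in>{0..<s}-{i}. U $$ (a,l) * U $$ (b,l))"
          unfolding M_def entry[OF Uc ab] using i by (subst sum.remove[of _ i]) auto
        ultimately show "(U' * U'\<^sup>T) $$ (a,b) = M $$ (a,b) + x $ a * x $ b - col U i $ a * col U i $ b"
          using ab i Uc by simp
      qed (use U'c in auto)
      then have "det (U' * U'\<^sup>T) = det M * q i"
        using det_exchange[OF M N MN x, of "col U i"] col_carrier_vec[OF i Uc] zi[OF i] by (simp add: q_def k_def)
      then have "\<bar>det M\<bar> * \<bar>q i\<bar> \<le> T" using DU' by (simp add: D_def abs_mult)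
      also have "\<dots> < \<bar>det M\<bar> * 2" using DU by (simp add: D_def M_def)
      finally show ?thesis using dM by simp
    qed
    then have "(\<Sum>i=0..<s. q i) \<le> (\<Sum>i=0..<s. 2)" by (intro sum_mono) simp
    \<comment> \<open>Bounding this by \<open>2 s\<close> with \<open>s = 2 r\<close> gives
      \<open>k (r + 1) \<le> 3 r\<close>; with \<open>s = r\<close> it would only give
      \<open>k \<le> 2 r\<close>.\<close>
    moreover have "(\<Sum>i=0..<s. q i) = (1 + k) * (real s - real r) + k"
      by (simp add: q_def sum.distrib sum_distrib_left[symmetric] sum_subtractf trace cross)
    ultimately have "k * (real r + 1) \<le> 3 * real r" by (simp add: s_def algebra_simps)
    also have "\<dots> \<le> 3 * (real r + 1)" by simp
    finally have "k \<le> 3" by (rule mult_right_le_imp_le) simp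
    then show ?thesis using z Uz zz by auto
  qed
  then show ?thesis using Uc UK unfolding s_def by blast
qed

section \<open>Elementary properties of the lp norm\<close>

lemma lp_norm_nonneg: "0 \<le> lp_norm p v"
  by (simp add: lp_norm_def)

lemma lp_norm_zero: "lp_norm p (0\<^sub>v n) = 0"
  by (simp add: lp_norm_def)

lemma lp_norm_powr:
  assumes "p \<noteq> 0"
  shows "lp_norm p v powr p = (\<Sum>i<dim_vec v. \<bar>v $ i\<bar> powr p)"
  using assms by (simp add: lp_norm_def powr_powr sum_nonneg)

lemma abs_index_le_lp_norm:
  assumes p: "p > 0" and i: "i < dim_vec v"
  shows "\<bar>v $ i\<bar> \<le> lp_norm p v"
proof -
  have "\<bar>v $ i\<bar> powr p \<le> (\<Sum>j<dim_vec v. \<bar>v $ j\<bar> powr p)"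
    using i by (intro member_le_sum) auto
  then have "(\<bar>v $ i\<bar> powr p) powr (1 / p) \<le> lp_norm p v"
    unfolding lp_norm_def using p by (intro powr_mono2) auto
  then show ?thesis using p by (simp add: powr_powr)
qed

lemma lp_norm_smult:
  assumes p: "p > 0"
  shows "lp_norm p (a \<cdot>\<^sub>v v) = \<bar>a\<bar> * lp_norm p v"
proof -
  have "lp_norm p (a \<cdot>\<^sub>v v) = (\<bar>a\<bar> powr p * (\<Sum>i<dim_vec v. \<bar>v $ i\<bar> powr p)) powr (1 / p)"
    by (simp add: lp_norm_def abs_mult powr_mult sum_distrib_left)
  also have "\<dots> = \<bar>a\<bar> * lp_norm p v"
    using p by (simp add: lp_norm_def powr_mult powr_powr sum_nonneg)
  finally show ?thesis .
qed

lemma lp_norm_2: "lp_norm 2 v = sqrt (v \<bullet> v)"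
proof -
  have "(\<Sum>i<dim_vec v. \<bar>v $ i\<bar> powr 2) = v \<bullet> v"
    unfolding scalar_prod_def lessThan_atLeast0
    by (intro sum.cong refl) (simp add: power2_eq_square)
  then show ?thesis
    by (simp add: lp_norm_def powr_half_sqrt scalar_prod_def sum_nonneg)
qed

section \<open>From the design to the spanning set\<close>

text \<open>The design is applied to the unit ball \<open>K\<close> of
  \<open>v \<mapsto> lp_norm p (B v)\<close>. Its columns in \<open>K\<close> bound the entrywise
  norm of \<open>U = B V\<close>, its bound 3 becomes the factor \<open>sqrt 3\<close>, and
  homogeneity extends the representation from \<open>K\<close> to every vector.\<close>

lemma lp_well_conditioned_spanning_set:
  fixes A :: "real mat"
  assumes A: "A \<in> carrier_mat n d" and p: "1 \<le> p"
  shows "\<exists>s U. s \<le> 2 * d \<and> U \<in> carrier_mat n s \<and> entrywise_lp_norm p U \<le> real s powr (1 / p) \<and>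
    (\<forall>x \<in> carrier_vec d. \<exists>z \<in> carrier_vec s.
      A *\<^sub>v x = U *\<^sub>v z \<and> lp_norm 2 z \<le> sqrt 3 * lp_norm p (U *\<^sub>v z))"
proof -
  have p0: "p > 0" using p by simp
  from full_rank_factorization[OF A] obtain r B L R where r: "r \<le> d"
    and B: "B \<in> carrier_mat n r" and L: "L \<in> carrier_mat r n" and R: "R \<in> carrier_mat r d"
    and AB: "A = B * R" and LB: "L * B = 1\<^sub>m r"
    by blast
  have LBv: "L *\<^sub>v (B *\<^sub>v v) = v" if "v \<in> carrier_vec r" for v
    using assoc_mult_mat_vec[OF L B that] that by (simp add: LB)
  have Bc: "B *\<^sub>v v \<in> carrier_vec n" if "v \<in> carrier_vec r" for v using B that by simp
  have Bsm: "B *\<^sub>v (a \<cdot>\<^sub>v v) = a \<cdot>\<^sub>v (B *\<^sub>v v)" if "v \<in> carrier_vec r" for a v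
    by (rule mult_mat_vec[OF B that])
  define K where "K = {v \<in> carrier_vec r. lp_norm p (B *\<^sub>v v) \<le> 1}"
  \<comment> \<open>For \<open>v\<close> in \<open>K\<close> the entries of \<open>B v\<close> are
    at most 1 in absolute value, and \<open>v = L (B v)\<close>, so \<open>c\<close> bounds the
    entries of \<open>v\<close>.\<close>
  define c where "c = (\<Sum>i=0..<r. \<Sum>j=0..<n. \<bar>L $$ (i,j)\<bar>)"
  have bd: "\<bar>v $ i\<bar> \<le> c" if v: "v \<in> K" and i: "i < r" for v i
  proof -
    have vc: "v \<in> carrier_vec r" and v1: "lp_norm p (B *\<^sub>v v) \<le> 1" using v by (auto simp: K_def)
    have "(L *\<^sub>v (B *\<^sub>v v)) $ i = (\<Sum>j=0..<n. L $$ (i,j) * (B *\<^sub>v v) $ j)"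
      using i L B Bc[OF vc]
      by (subst index_mult_mat_vec) (auto simp: scalar_prod_def simp del: index_mult_mat_vec)
    then have "v $ i = (\<Sum>j=0..<n. L $$ (i,j) * (B *\<^sub>v v) $ j)"
      by (simp only: LBv[OF vc])
    then have "\<bar>v $ i\<bar> \<le> (\<Sum>j=0..<n. \<bar>L $$ (i,j) * (B *\<^sub>v v) $ j\<bar>)"
      by simp
    also have "\<dots> \<le> (\<Sum>j=0..<n. \<bar>L $$ (i,j)\<bar> * 1)"
    proof (rule sum_mono)
      fix j assume "j \<in> {0..<n}"
      then have "\<bar>(B *\<^sub>v v) $ j\<bar> \<le> 1"
        using abs_index_le_lp_norm[OF p0, of j "B *\<^sub>v v"] v1 B by simp
      then show "\<bar>L $$ (i,j) * (B *\<^sub>v v) $ j\<bar> \<le> \<bar>L $$ (i,j)\<bar> * 1"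
        unfolding abs_mult by (intro mult_left_mono) auto
    qed
    also have "\<dots> \<le> c"
      unfolding c_def using i
      by (simp, intro member_le_sum[where f = "\<lambda>i. \<Sum>j=0..<n. \<bar>L $$ (i,j)\<bar>"]) (auto intro: sum_nonneg)
    finally show ?thesis .
  qed
  have zero: "0\<^sub>v r \<in> K"
  proof -
    have "B *\<^sub>v 0\<^sub>v r = 0\<^sub>v n" using B by (intro eq_vecI) auto
    then show ?thesis by (simp add: K_def lp_norm_zero)
  qed
  \<comment> \<open>One scale that brings all unit vectors into \<open>K\<close>; the summand 1
    keeps \<open>t\<close> positive even for \<open>r = 0\<close>.\<close>
  define t where "t = 1 + (\<Sum>i=0..<r. lp_norm p (B *\<^sub>v unit_vec r i))"
  have t1: "t \<ge> 1" unfolding t_def by (simp add: sum_nonneg lp_norm_nonneg)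
  have unit: "(1 / t) \<cdot>\<^sub>v unit_vec r i \<in> K" if i: "i < r" for i
  proof -
    have "lp_norm p (B *\<^sub>v unit_vec r i) \<le> (\<Sum>i=0..<r. lp_norm p (B *\<^sub>v unit_vec r i))"
      using i by (intro member_le_sum[where f = "\<lambda>i. lp_norm p (B *\<^sub>v unit_vec r i)"])
        (auto simp: lp_norm_nonneg)
    then have "lp_norm p (B *\<^sub>v unit_vec r i) \<le> t" unfolding t_def by simp
    then show ?thesis using t1 by (simp add: K_def Bsm lp_norm_smult[OF p0])
  qed
  obtain V where V: "V \<in> carrier_mat r (2 * r)" and VK: "\<And>j. j < 2 * r \<Longrightarrow> col V j \<in> K"
    and cov: "\<And>x. x \<in> K \<Longrightarrow> \<exists>z \<in> carrier_vec (2 * r). V *\<^sub>v z = x \<and> z \<bullet> z \<le> 3"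
    using near_D_optimal_design[of K r c "1 / t", OF _ bd zero _ unit] t1 by (auto simp: K_def)
  define U where "U = B * V"
  have U: "U \<in> carrier_mat n (2 * r)" using B V by (simp add: U_def)
  have "entrywise_lp_norm p U \<le> real (2 * r) powr (1 / p)"
  proof -
    \<comment> \<open>Grouped by columns, the sum has \<open>2 * r\<close> terms, each at most 1
      because the columns of \<open>V\<close> lie in \<open>K\<close>.\<close>
    have "(\<Sum>i<n. \<Sum>j<2 * r. \<bar>U $$ (i,j)\<bar> powr p) = (\<Sum>j<2 * r. lp_norm p (B *\<^sub>v col V j) powr p)"
      using p0 U B V
      by (subst sum.swap) (intro sum.cong refl, simp add: lp_norm_powr U_def)
    also have "\<dots> \<le> (\<Sum>j<2 * r. 1)"
    proof (rule sum_mono)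
      fix j assume "j \<in> {..<2 * r}"
      then have "lp_norm p (B *\<^sub>v col V j) \<le> 1" using VK by (simp add: K_def)
      then show "lp_norm p (B *\<^sub>v col V j) powr p \<le> 1"
        using powr_mono2[of p _ 1] p0 lp_norm_nonneg by simp
    qed
    finally show ?thesis
      using U p0 unfolding entrywise_lp_norm_def by (intro powr_mono2) (auto intro!: sum_nonneg)
  qed
  moreover have "\<exists>z \<in> carrier_vec (2 * r). A *\<^sub>v x = U *\<^sub>v z \<and> lp_norm 2 z \<le> sqrt 3 * lp_norm p (U *\<^sub>v z)"
    if x: "x \<in> carrier_vec d" for x
  proof -
    define y where "y = R *\<^sub>v x"
    define m where "m = lp_norm p (B *\<^sub>v y)"
    have y: "y \<in> carrier_vec r" unfolding y_def by (rule mult_mat_vec_carrier[OF R x])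
    have Ax: "A *\<^sub>v x = B *\<^sub>v y" unfolding AB y_def by (rule assoc_mult_mat_vec[OF B R x])
    have m0: "m \<ge> 0" by (simp add: m_def lp_norm_nonneg)
    \<comment> \<open>Normalizing \<open>y\<close> by \<open>m\<close> lands in \<open>K\<close>; if
      \<open>m = 0\<close>, injectivity of \<open>B\<close> forces \<open>y = 0\<close> and
      \<open>w = 0\<close> serves.\<close>
    have "\<exists>w \<in> K. y = m \<cdot>\<^sub>v w"
    proof (cases "m = 0")
      case True
      then have "B *\<^sub>v y = 0\<^sub>v n"
        using abs_index_le_lp_norm[OF p0, of _ "B *\<^sub>v y"] B
        by (intro eq_vecI) (auto simp: m_def simp del: index_mult_mat_vec)
      then have "y = L *\<^sub>v 0\<^sub>v n" using LBv[OF y] by simp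
      also have "\<dots> = 0\<^sub>v r" using L by (intro eq_vecI) auto
      finally show ?thesis using zero True by (intro bexI[of _ "0\<^sub>v r"]) auto
    next
      case False
      then have "(1 / m) \<cdot>\<^sub>v y \<in> K"
        using y m0 by (simp add: K_def Bsm lp_norm_smult[OF p0] m_def[symmetric])
      moreover have "y = m \<cdot>\<^sub>v ((1 / m) \<cdot>\<^sub>v y)"
        using False by (simp add: smult_smult_assoc)
      ultimately show ?thesis by blast
    qed
    then obtain w where w: "w \<in> K" and yw: "y = m \<cdot>\<^sub>v w" by blast
    from cov[OF w] obtain z where z: "z \<in> carrier_vec (2 * r)" and Vz: "V *\<^sub>v z = w"
      and z3: "z \<bullet> z \<le> 3" by blast
    have "U *\<^sub>v (m \<cdot>\<^sub>v z) = B *\<^sub>v (V *\<^sub>v (m \<cdot>\<^sub>v z))"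
      unfolding U_def by (rule assoc_mult_mat_vec[OF B V]) (use z in simp)
    also have "\<dots> = B *\<^sub>v y" by (simp add: mult_mat_vec[OF V z] Vz yw)
    finally have Uz: "U *\<^sub>v (m \<cdot>\<^sub>v z) = B *\<^sub>v y" .
    have "lp_norm 2 (m \<cdot>\<^sub>v z) = m * sqrt (z \<bullet> z)"
      using m0 by (subst lp_norm_smult) (simp_all add: lp_norm_2)
    also have "\<dots> \<le> sqrt 3 * m" using z3 m0 by (simp add: mult.commute mult_left_mono)
    finally show ?thesis
      using z by (intro bexI[of _ "m \<cdot>\<^sub>v z"]) (simp_all add: Uz Ax m_def[symmetric])
  qed
  ultimately show ?thesis using U r by (intro exI[of _ "2 * r"] exI[of _ U]) auto
qed

section \<open>The bound with explicit absolute constants\<close>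

theorem theorem1p11:
  shows "\<exists>C\<^sub>1 C\<^sub>2 :: real. \<forall>(n::nat) (d::nat) (A::real mat) (p::real).
    A \<in> carrier_mat n d \<and> 1 \<le> p \<longrightarrow>
    (\<exists>(s::nat) (U::real mat).
       real s \<le> C\<^sub>1 * (real d * loglog d) \<and>
       U \<in> carrier_mat n s \<and>
       entrywise_lp_norm p U \<le> real s powr (1 / p) \<and>
       (\<forall>x \<in> carrier_vec d. \<exists>z \<in> carrier_vec s.
          A *\<^sub>v x = U *\<^sub>v z \<and> lp_norm 2 z \<le> C\<^sub>2 * lp_norm p (U *\<^sub>v z)))"
proof (rule exI[of _ 2], rule exI[of _ "sqrt 3"], intro allI impI)
  fix n d :: nat and A :: "real mat" and p :: real
  assume "A \<in> carrier_mat n d \<and> 1 \<le> p"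
  then obtain s U where s: "s \<le> 2 * d" and U: "U \<in> carrier_mat n s"
    "entrywise_lp_norm p U \<le> real s powr (1 / p)"
    "\<forall>x \<in> carrier_vec d. \<exists>z \<in> carrier_vec s.
      A *\<^sub>v x = U *\<^sub>v z \<and> lp_norm 2 z \<le> sqrt 3 * lp_norm p (U *\<^sub>v z)"
    using lp_well_conditioned_spanning_set by blast
  \<comment> \<open>The size is already linear in \<open>d\<close>; since \<open>loglog d\<close> is
    at least 1, the stated bound follows.\<close>
  have "real s \<le> 2 * (real d * 1)" using s by simp
  also have "\<dots> \<le> 2 * (real d * loglog d)"
    by (intro mult_left_mono) (auto simp: loglog_def)
  finally show "\<exists>s U. real s \<le> 2 * (real d * loglog d) \<and> U \<in> carrier_mat n s \<and>
      entrywise_lp_norm p U \<le> real s powr (1 / p) \<and>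
      (\<forall>x \<in> carrier_vec d. \<exists>z \<in> carrier_vec s.
        A *\<^sub>v x = U *\<^sub>v z \<and> lp_norm 2 z \<le> sqrt 3 * lp_norm p (U *\<^sub>v z))"
    using U by blast
qed

end
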